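(* Let $k$ be a field of prime characteristic $p$ and let $A\in pdCom_k$ be a divided powers algebra. Then any special derivation of $A$ is a Beck derivation, i.e. it belongs to $\mathrm{Der}_p(A,A)$, where $A$ is regarded as a Beck $A$-module by means of multiplication together with the zero map $\pi_A=0:A\to A$.
   Context: Let $k$ be a field of prime characteristic $p$. A system of divided powers on an ideal $I$ of a commutative ring $A$ is a family of maps $\gamma_i:I\to A$, $i\ge0$, with $\gamma_0(x)=1$, $\gamma_1(x)=x$, $\gamma_i(x)\in I$ for $i\geq 1$, $\gamma_i(x+y)=\sum_{j=0}^i\gamma_j(x)\gamma_{i-j}(y)$, $\gamma_i(ax)=a^i\gamma_i(x)$, $\gamma_i(x)\gamma_j(x)=\frac{(i+j)!}{i!j!}\gamma_{i+j}(x)$, and $\gamma_i(\gamma_j(x))=\frac{(ij)!}{i!(j!)^i}\gamma_{ij}(x)$ (for $j\ge1$ in the last relation), for $x,y\in I$, $a\in A$. An object of $pdCom_k$ (a divided powers algebra) is a commutative augmented $k$-algebra $A=k\oplus A_+$ with a system of divided powers $\gamma_i$ on the augmentation ideal $A_+$. The system is uniquely determined by its $p$-map $\pi:=\gamma_p:A_+\to A_+$. A $k$-linear derivation $D:A\to A$ is called special if $D(\gamma_i(x))=\gamma_{i-1}(x)D(x)$ for all $x\in A_+$ and $i\ge0$ (with $\gamma_{-1}=0$). A Beck $A$-module is a pair $(M,\pi_M)$ with $M$ an $A$-module and $\pi_M:M\to M$ additive, $\pi_M(\lambda m)=\lambda^p\pi_M(m)$ for $\lambda\in k$, and $\pi_M(am)=0$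 for $a\in A_+$, $m\in M$. The group of Beck derivations is $\mathrm{Der}_p(A,(M,\pi_M))=\{D\in\mathrm{Der}_k(A,M)\mid D(\pi(a))=\pi_M(D(a))-a^{p-1}D(a)\ \text{for all }a\in A_+\}$. *)

theory Defs
  imports Complex_Main "HOL-Computational_Algebra.Primes"
begin

text \<open>
  Ideals of a commutative ring are the submodules of the ring acting on itself by
  multiplication. The maps \<open>\<gamma> i\<close> are total functions, but only their values on \<open>I\<close> matter.
  The coefficients in the last two laws are integers, so the natural-number divisions
  are exact; they are carried out before mapping into the ring.
\<close>

locale divided_powers =
  fixes I :: "'a::comm_ring_1 set" and \<gamma> :: "nat \<Rightarrow> 'a \<Rightarrow> 'a"
  assumes ideal: "module.subspace (*) I"
    and gamma_0: "x \<in> I \<Longrightarrow> \<gamma> 0 x = 1"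
    and gamma_1: "x \<in> I \<Longrightarrow> \<gamma> 1 x = x"
    and gamma_in: "x \<in> I \<Longrightarrow> i \<ge> 1 \<Longrightarrow> \<gamma> i x \<in> I"
    and gamma_add: "x \<in> I \<Longrightarrow> y \<in> I \<Longrightarrow> \<gamma> i (x + y) = (\<Sum>j=0..i. \<gamma> j x * \<gamma> (i - j) y)"
    and gamma_mult: "x \<in> I \<Longrightarrow> \<gamma> i (a * x) = a ^ i * \<gamma> i x"
    and gamma_mult_gamma:
      "x \<in> I \<Longrightarrow> \<gamma> i x * \<gamma> j x = of_nat (fact (i + j) div (fact i * fact j)) * \<gamma> (i + j) x"
    and gamma_gamma:
      "x \<in> I \<Longrightarrow> j \<ge> 1 \<Longrightarrow>
        \<gamma> i (\<gamma> j x) = of_nat (fact (i * j) div (fact i * fact j ^ i)) * \<gamma> (i * j) x"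

locale augmented_algebra = vector_space scale
  for scale :: "'k::field \<Rightarrow> 'a::comm_ring_1 \<Rightarrow> 'a" +
  fixes \<epsilon> :: "'a \<Rightarrow> 'k"
  assumes scale_mult: "scale c (x * y) = scale c x * y"
    and aug_linear: "Vector_Spaces.linear scale (*) \<epsilon>"
    and aug_mult: "\<epsilon> (x * y) = \<epsilon> x * \<epsilon> y"
    and aug_one: "\<epsilon> 1 = 1"

definition aug_ideal :: "('a::comm_ring_1 \<Rightarrow> 'k::field) \<Rightarrow> 'a set" where
  "aug_ideal \<epsilon> = {x. \<epsilon> x = 0}"

locale pd_algebra =
  augmented_algebra scale \<epsilon> + divided_powers "aug_ideal \<epsilon>" \<gamma>
  for scale :: "'k::field \<Rightarrow> 'a::comm_ring_1 \<Rightarrow> 'a" and \<epsilon> :: "'a \<Rightarrow> 'k"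
    and \<gamma> :: "nat \<Rightarrow> 'a \<Rightarrow> 'a"

text \<open>
  An \<open>A\<close>-module \<open>M\<close>, with action \<open>act\<close>, is a \<open>k\<close>-vector space by restriction along
  \<open>\<lambda>c. scale c 1\<close>, the unit map of the \<open>k\<close>-algebra \<open>A\<close>.
\<close>

definition restrict_scalars ::
    "('k::field \<Rightarrow> 'a::comm_ring_1 \<Rightarrow> 'a) \<Rightarrow> ('a \<Rightarrow> 'm::ab_group_add \<Rightarrow> 'm) \<Rightarrow> 'k \<Rightarrow> 'm \<Rightarrow> 'm" where
  "restrict_scalars scale act c m = act (scale c 1) m"

definition derivations ::
    "('k::field \<Rightarrow> 'a::comm_ring_1 \<Rightarrow> 'a) \<Rightarrow> ('a \<Rightarrow> 'm::ab_group_add \<Rightarrow> 'm) \<Rightarrow> ('a \<Rightarrow> 'm) set" where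
  "derivations scale act =
    {D. Vector_Spaces.linear scale (restrict_scalars scale act) D \<and>
        (\<forall>a b. D (a * b) = act a (D b) + act b (D a))}"

text \<open>The case \<open>i = 0\<close> is the convention that \<open>\<gamma>\<close> with index \<open>-1\<close> is zero.\<close>

definition special_derivation ::
    "('k::field \<Rightarrow> 'a::comm_ring_1 \<Rightarrow> 'a) \<Rightarrow> ('a \<Rightarrow> 'k) \<Rightarrow> (nat \<Rightarrow> 'a \<Rightarrow> 'a) \<Rightarrow> ('a \<Rightarrow> 'a) \<Rightarrow> bool" where
  "special_derivation scale \<epsilon> \<gamma> D \<longleftrightarrow>
    D \<in> derivations scale (*) \<and>
    (\<forall>x\<in>aug_ideal \<epsilon>. \<forall>i. D (\<gamma> i x) = (if i = 0 then 0 else \<gamma> (i - 1) x) * D x)"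

locale beck_module = augmented_algebra scale \<epsilon> + M: module act
  for scale :: "'k::field \<Rightarrow> 'a::comm_ring_1 \<Rightarrow> 'a" and \<epsilon> :: "'a \<Rightarrow> 'k"
    and act :: "'a \<Rightarrow> 'm::ab_group_add \<Rightarrow> 'm" +
  fixes \<pi>M :: "'m \<Rightarrow> 'm"
  assumes piM_add: "\<pi>M (m + n) = \<pi>M m + \<pi>M n"
    and piM_scale:
      "\<pi>M (restrict_scalars scale act c m) = restrict_scalars scale act (c ^ CHAR('k)) (\<pi>M m)"
    and piM_aug: "a \<in> aug_ideal \<epsilon> \<Longrightarrow> \<pi>M (act a m) = 0"

text \<open>With \<open>p = CHAR('k)\<close>, the \<open>p\<close>-map \<open>\<pi>\<close> of the divided powers algebra is \<open>\<gamma> p\<close>.\<close>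

definition beck_derivations ::
    "('k::field \<Rightarrow> 'a::comm_ring_1 \<Rightarrow> 'a) \<Rightarrow> ('a \<Rightarrow> 'k) \<Rightarrow> (nat \<Rightarrow> 'a \<Rightarrow> 'a) \<Rightarrow>
      ('a \<Rightarrow> 'm::ab_group_add \<Rightarrow> 'm) \<Rightarrow> ('m \<Rightarrow> 'm) \<Rightarrow> ('a \<Rightarrow> 'm) set" where
  "beck_derivations scale \<epsilon> \<gamma> act \<pi>M =
    {D \<in> derivations scale act.
      \<forall>a\<in>aug_ideal \<epsilon>. D (\<gamma> CHAR('k) a) = \<pi>M (D a) - act (a ^ (CHAR('k) - 1)) (D a)}"

end

theory Submission
  imports Defs "HOL-Number_Theory.Residues"
begin

text \<open>
  Iterating \<open>x * \<gamma> n x = (n + 1) * \<gamma> (n + 1) x\<close> gives \<open>x ^ n = n! * \<gamma> n x\<close>. In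
  characteristic \<open>p\<close>, Wilson's theorem turns the case \<open>n = p - 1\<close> into
  \<open>\<gamma> (p - 1) x = - x ^ (p - 1)\<close>, so the special rule for \<open>D (\<gamma> p x)\<close> is the Beck rule.
\<close>

lemma (in divided_powers) power_eq_fact_gamma:
  assumes "x \<in> I"
  shows "x ^ n = of_nat (fact n) * \<gamma> n x"
proof (induction n)
  case 0
  then show ?case using assms by (simp add: gamma_0)
next
  case (Suc n)
  \<comment> \<open>The quotient of factorials is evaluated in the naturals, where the division is
    exact, before \<open>of_nat\<close> is applied.\<close>
  have coeff: "fact (1 + n) div (fact 1 * fact n) = Suc n"
    by simp
  have "x * \<gamma> n x = of_nat (Suc n) * \<gamma> (Suc n) x"
    using gamma_mult_gamma[OF assms, of 1 n] unfolding coeff gamma_1[OF assms] by simp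
  \<comment> \<open>The factor \<open>fact n\<close> lets the induction hypothesis turn the left
    side into \<open>x * x ^ n\<close>.\<close>
  then have "of_nat (fact n) * (x * \<gamma> n x) = of_nat (fact n * Suc n) * \<gamma> (Suc n) x"
    by (simp only: of_nat_mult mult.assoc)
  also have "fact n * Suc n = fact (Suc n)"
    by simp
  finally show ?case
    using Suc.IH by (simp only: power_Suc mult.left_commute)
qed

text \<open>Wilson's congruence is an identity in the integers up to a multiple of \<open>p\<close>;
  the canonical map \<open>of_int\<close> into the ring kills that multiple.\<close>

lemma of_nat_fact_pred_prime:
  assumes "prime p" and "of_nat p = (0 :: 'a::comm_ring_1)"
  shows "of_nat (fact (p - 1)) = (- 1 :: 'a)"
proof -
  have "int p dvd fact (p - 1) + 1"
    using wilson_theorem[OF assms(1)] by (simp add: cong_iff_dvd_diff)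
  then obtain m :: int where m: "fact (p - 1) + 1 = int p * m" ..
  have "(of_nat (fact (p - 1)) :: 'a) + 1 = of_int (int (fact (p - 1)) + 1)"
    by (simp only: of_int_add of_int_of_nat_eq of_int_1)
  also have "int (fact (p - 1)) + 1 = int p * m"
    using m by simp
  finally show ?thesis
    using assms(2) by (simp add: eq_neg_iff_add_eq_0)
qed

lemma (in divided_powers) gamma_pred_prime:
  assumes "prime p" and "of_nat p = (0 :: 'a)" and "x \<in> I"
  shows "\<gamma> (p - 1) x = - (x ^ (p - 1))"
  using power_eq_fact_gamma[OF assms(3), of "p - 1"]
    of_nat_fact_pred_prime[OF assms(1,2)]
  by simp

text \<open>The unit map sending \<open>c\<close> to \<open>scale c 1\<close> preserves
  natural-number multiples of 1, so the vanishing of \<open>CHAR('k)\<close> in the field passes to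
  the algebra.\<close>

lemma (in augmented_algebra) of_nat_CHAR_eq_0: "of_nat CHAR('k) = (0 :: 'a)"
proof -
  have "scale (of_nat n) 1 = of_nat n" for n
    by (induction n) (simp_all add: scale_left_distrib)
  from this[of "CHAR('k)"] show ?thesis
    by simp
qed

lemma (in augmented_algebra) beck_module_zero: "beck_module scale \<epsilon> (*) (\<lambda>_::'a. 0)"
  by unfold_locales (simp_all add: algebra_simps restrict_scalars_def)

text \<open>A prime is nonzero, so the special rule at index \<open>CHAR('k)\<close> falls in its
  second branch, with the coefficient \<open>\<gamma> (CHAR('k) - 1) a\<close> just
  computed.\<close>

lemma (in pd_algebra) special_derivation_imp_beck:
  assumes "prime CHAR('k)" and "special_derivation scale \<epsilon> \<gamma> D"
  shows "D \<in> beck_derivations scale \<epsilon> \<gamma> (*) (\<lambda>_. 0)"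
  using assms gamma_pred_prime[OF assms(1) of_nat_CHAR_eq_0]
  by (auto simp: special_derivation_def beck_derivations_def)

theorem proposition2p3:
  fixes scale :: "'k::field \<Rightarrow> 'a::comm_ring_1 \<Rightarrow> 'a"
    and \<epsilon> :: "'a \<Rightarrow> 'k"
    and \<gamma> :: "nat \<Rightarrow> 'a \<Rightarrow> 'a"
  assumes "prime CHAR('k)"
    and "pd_algebra scale \<epsilon> \<gamma>"
  shows "beck_module scale \<epsilon> (*) (\<lambda>_::'a. 0) \<and>
    (\<forall>D. special_derivation scale \<epsilon> \<gamma> D \<longrightarrow> D \<in> beck_derivations scale \<epsilon> \<gamma> (*) (\<lambda>_. 0))"
proof -
  interpret pd_algebra scale \<epsilon> \<gamma> by fact
  show ?thesis
    using beck_module_zero special_derivation_imp_beck[OF assms(1)] by blast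
qed

end
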